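(* Consider the Probabilistic Serial mechanism with $n$ agents and $m \le n$ items in the following dichotomous setting for agent 1. Agent 1 has a true strict linear order $\succ_1$ over the items; let $\overline{O}$ be the set of its $k$ most preferred items under $\succ_1$ (for some $1 \le k \le m$), and let agent 1's utility from an allocation be the total amount it receives of items in $\overline{O}$. Fix arbitrary reported strict linear orders of agents $2,\dots,n$. Let $u_1$ be agent 1's utility when it reports $\succ_1$, and let $T$ be the time at which the last item of $\overline{O}$ is exhausted in this truthful run. If $\tfrac12 \le T < \tfrac23$, then for every strict linear order $\succ'_1$ reported by agent 1, its resulting utility $u'_1$ satisfies $u'_1 \le \tfrac32 u_1$.
   Context: Probabilistic Serial: there are $n$ agents and $m$ divisible items of unit supply; each agent reports a strict linear order over all items. Starting at time $0$, every agent consumes at rate $1$ per unit time its most preferred item (according to its report) among those with positive remaining supply; when an item is exhausted, agents consuming it move to their most preferred item still available; this continues until all items are exhausted. Each agent's allocation is the amount of each item it consumed. (In the truthful run agent 1 eats only items of $\overline{O}$ until time $T$, so $u_1 = T$.) *)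

theory Defs
  imports Complex_Main
begin

(* Probabilistic Serial (PS).
   Agents are 0..<n (the paper's agent 1 is agent 0), items are 0..<m.
   A preference profile P maps each agent to a list that is a strict linear
   order over the items (most preferred first).  A state of the eating
   process is (time, remaining supply, allocation, exhaustion time). *)

definition is_pref :: "nat \<Rightarrow> nat list \<Rightarrow> bool" where
  "is_pref m L \<longleftrightarrow> distinct L \<and> set L = {..<m}"

definition avail :: "nat \<Rightarrow> (nat \<Rightarrow> real) \<Rightarrow> nat set" where
  "avail m s = {j. j < m \<and> 0 < s j}"

definition eating :: "(nat \<Rightarrow> real) \<Rightarrow> (nat \<Rightarrow> nat list) \<Rightarrow> nat \<Rightarrow> nat" where
  "eating s P i = hd (filter (\<lambda>j. 0 < s j) (P i))"

definition eaters :: "nat \<Rightarrow> (nat \<Rightarrow> real) \<Rightarrow> (nat \<Rightarrow> nat list) \<Rightarrow> nat \<Rightarrow> nat" where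
  "eaters n s P j = card {i. i < n \<and> eating s P i = j}"

definition step_len :: "nat \<Rightarrow> nat \<Rightarrow> (nat \<Rightarrow> real) \<Rightarrow> (nat \<Rightarrow> nat list) \<Rightarrow> real" where
  "step_len n m s P =
     Min {s j / real (eaters n s P j) | j. j \<in> avail m s \<and> 0 < eaters n s P j}"

type_synonym ps_state = "real \<times> (nat \<Rightarrow> real) \<times> (nat \<Rightarrow> nat \<Rightarrow> real) \<times> (nat \<Rightarrow> real)"

definition ps_step :: "nat \<Rightarrow> nat \<Rightarrow> (nat \<Rightarrow> nat list) \<Rightarrow> ps_state \<Rightarrow> ps_state" where
  "ps_step n m P st = (case st of (t, s, a, e) \<Rightarrow>
     if avail m s = {} then st else
     (let d = step_len n m s P;
          s' = (\<lambda>j. if j \<in> avail m s then s j - real (eaters n s P j) * d else s j)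
      in (t + d,
          s',
          (\<lambda>i j. if i < n \<and> j \<in> avail m s \<and> eating s P i = j then a i j + d else a i j),
          (\<lambda>j. if j \<in> avail m s \<and> s' j = 0 then t + d else e j))))"

(* every phase exhausts at least one item, so m phases finish the process *)
definition ps_run :: "nat \<Rightarrow> nat \<Rightarrow> (nat \<Rightarrow> nat list) \<Rightarrow> ps_state" where
  "ps_run n m P = (ps_step n m P ^^ m) (0, (\<lambda>j. 1), (\<lambda>i j. 0), (\<lambda>j. 0))"

definition ps_alloc :: "nat \<Rightarrow> nat \<Rightarrow> (nat \<Rightarrow> nat list) \<Rightarrow> nat \<Rightarrow> nat \<Rightarrow> real" where
  "ps_alloc n m P = fst (snd (snd (ps_run n m P)))"

definition ps_exh :: "nat \<Rightarrow> nat \<Rightarrow> (nat \<Rightarrow> nat list) \<Rightarrow> nat \<Rightarrow> real" where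
  "ps_exh n m P = snd (snd (snd (ps_run n m P)))"

end

theory Submission
  imports Defs "HOL-Analysis.Analysis"
begin

text \<open>
  Run the truthful report (run A) and the manipulation (run B) side by side in continuous time.
  As long as the other agents report the same preferences, any of them eating in A an item of
  which B has more left than A also eats in B an item of which B has more left. Hence the total
  surplus of B over A grows only because of agent 0, at rate at most 1, and at time \<open>T\<close> it is at
  most \<open>T\<close>: run B has at most \<open>T\<close> units left of the set \<open>X\<close> of items exhausted in A.

  Since \<open>T < 1\<close>, agent 0 did not exhaust any top item alone in A, and whoever shared it is still
  eating from \<open>X\<close> in B while that item lasts. So after time \<open>T\<close> each unit of top items that
  agent 0 eats in B removes two units of \<open>X\<close>, and agent 0 gains at most \<open>T / 2\<close> on top of the at
  most \<open>T\<close> units it ate before.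
\<close>

section \<open>Bounds from one-sided slopes\<close>

lemma le_of_right_slope_le:
  fixes f :: "real \<Rightarrow> real"
  assumes ab: "a \<le> b" and cont: "continuous_on {a..b} f"
    and slope: "\<And>t. a \<le> t \<Longrightarrow> t < b \<Longrightarrow> \<forall>\<^sub>F h in at_right 0. f (t + h) \<le> f t + c * h"
  shows "f b \<le> f a + c * (b - a)"
proof -
  \<comment> \<open>Continuous induction: \<open>A\<close> collects the times at which the bound
    holds. It is compact, so it has a largest element, and the slope condition there would carry the
    bound further unless that element is \<open>b\<close>. Only right slopes enter, so kinks at
    phase boundaries do no harm.\<close>
  define A where "A = {t \<in> {a..b}. f t - c * t \<le> f a - c * a}"
  have "closed A"
    unfolding A_def
    by (intro continuous_on_closed_Collect_le continuous_intros cont closed_atLeastAtMost)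
  moreover have "bounded A"
    by (rule bounded_subset[of "{a..b}"]) (auto simp: A_def)
  ultimately have "compact A" by (simp add: compact_eq_bounded_closed)
  moreover have "a \<in> A" using ab by (simp add: A_def)
  ultimately obtain t where t: "t \<in> A" "\<And>u. u \<in> A \<Longrightarrow> u \<le> t"
    using compact_attains_sup[of A] by blast
  have "t = b"
  proof (rule ccontr)
    assume "t \<noteq> b"
    with t(1) have tb: "a \<le> t" "t < b" by (auto simp: A_def)
    have "\<forall>\<^sub>F h in at_right 0. h < b - t"
      using tb by (intro order_tendstoD[of "\<lambda>h. h"] tendsto_ident_at) auto
    moreover have "\<forall>\<^sub>F h in at_right (0::real). 0 < h"
      by (rule eventually_at_right_less)
    ultimately have "\<forall>\<^sub>F h in at_right 0. 0 < h \<and> h < b - t \<and> f (t + h) \<le> f t + c * h"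
      using slope[OF tb] by eventually_elim auto
    then obtain h where h: "0 < h" "h < b - t" "f (t + h) \<le> f t + c * h"
      using eventually_happens'[OF trivial_limit_at_right_real] by blast
    then have "t + h \<in> A" using t(1) by (auto simp: A_def algebra_simps)
    with t(2)[of "t + h"] h(1) show False by simp
  qed
  then show ?thesis using t(1) by (auto simp: A_def algebra_simps)
qed

lemma eventually_linear_less:
  fixes x y p q :: real
  assumes "x < y"
  shows "\<forall>\<^sub>F h in at_right 0. x - h * p < y - h * q"
proof -
  have "((\<lambda>h. (y - h * q) - (x - h * p)) \<longlongrightarrow> (y - 0 * q) - (x - 0 * p)) (at_right 0)"
    by (intro tendsto_intros)
  then have "\<forall>\<^sub>F h in at_right 0. 0 < (y - h * q) - (x - h * p)"
    by (rule order_tendstoD) (use assms in simp)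
  then show ?thesis by eventually_elim simp
qed

section \<open>The item an agent eats, and how fast items are eaten\<close>

lemma eating_prefix:
  assumes "0 < s j" "P i = ys @ j # zs"
  shows "eating s P i \<in> insert j (set ys)" "0 < s (eating s P i)"
proof -
  \<comment> \<open>Item \<open>j\<close> survives the filter, so the head is already decided by the
    part of the list that ends in \<open>j\<close>.\<close>
  have "eating s P i = hd (filter (\<lambda>j. 0 < s j) (ys @ [j]))"
    using assms by (cases "filter (\<lambda>j. 0 < s j) ys") (auto simp: eating_def)
  moreover have "hd (filter (\<lambda>j. 0 < s j) (ys @ [j])) \<in> set (filter (\<lambda>j. 0 < s j) (ys @ [j]))"
    using assms by (intro hd_in_set) auto
  ultimately show "eating s P i \<in> insert j (set ys)" "0 < s (eating s P i)" by auto
qed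

lemma eating_splitE:
  assumes "eating s P i = j" "0 < s j" "j \<in> set (P i)"
  obtains ys zs where "P i = ys @ j # zs" "\<And>y. y \<in> set ys \<Longrightarrow> s y \<le> 0"
proof -
  have "filter (\<lambda>j. 0 < s j) (P i) \<noteq> []" using assms by (auto simp: filter_empty_conv)
  then have "filter (\<lambda>j. 0 < s j) (P i) = j # tl (filter (\<lambda>j. 0 < s j) (P i))"
    using assms(1) unfolding eating_def by (metis list.collapse)
  from this[unfolded filter_eq_Cons_iff] show thesis using that by (auto simp: not_less)
qed

text \<open>Every item ranked above \<open>j\<close> is exhausted under \<open>s\<close>. If
  \<open>j\<close> is still available under \<open>s'\<close>, the choice there is \<open>j\<close>
  itself or one of those higher items. Both comparisons of the two runs rest on this.\<close>

lemma eating_compare: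
  assumes "eating s P i = j" "0 < s j" "j \<in> set (P i)" "0 < s' j" "Q i = P i"
  shows "0 < s' (eating s' Q i)" "eating s' Q i \<in> set (P i)"
    "eating s' Q i = j \<or> s (eating s' Q i) \<le> 0"
proof -
  obtain ys zs where *: "P i = ys @ j # zs" "\<And>y. y \<in> set ys \<Longrightarrow> s y \<le> 0"
    using eating_splitE[of s P i j] assms(1-3) by blast
  have "Q i = ys @ j # zs" using * assms by simp
  from eating_prefix[of s' j Q i, OF assms(4) this] *
  show "0 < s' (eating s' Q i)" "eating s' Q i \<in> set (P i)"
    "eating s' Q i = j \<or> s (eating s' Q i) \<le> 0" by auto
qed

text \<open>When nothing in the list of the agent is left, \<open>eating\<close> is
  \<open>hd []\<close>, an unspecified value; requiring positive stock keeps it from counting as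
  consumption.\<close>

definition eats :: "(nat \<Rightarrow> real) \<Rightarrow> (nat \<Rightarrow> nat list) \<Rightarrow> nat \<Rightarrow> nat \<Rightarrow> bool" where
  "eats s P i j \<longleftrightarrow> 0 < s j \<and> eating s P i = j"

definition rate :: "nat \<Rightarrow> (nat \<Rightarrow> real) \<Rightarrow> (nat \<Rightarrow> nat list) \<Rightarrow> nat \<Rightarrow> real" where
  "rate n s P j = (\<Sum>i<n. of_bool (eats s P i j))"

lemma rate_nonneg: "0 \<le> rate n s P j"
  by (simp add: rate_def sum_nonneg)

lemma rate_eq_eaters: "rate n s P j = (if 0 < s j then real (eaters n s P j) else 0)"
proof -
  have "{..<n} \<inter> {i. eating s P i = j} = {i. i < n \<and> eating s P i = j}" by auto
  then show ?thesis
    by (simp add: rate_def eats_def eaters_def sum.If_cases of_bool_def)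
qed

lemma sum_eats:
  assumes "finite D"
  shows "(\<Sum>j\<in>D. of_bool (eats s P i j)) = (of_bool (\<exists>j\<in>D. eats s P i j) :: real)"
proof -
  have "(\<Sum>j\<in>D. of_bool (eats s P i j)) =
      (\<Sum>j\<in>D. if eating s P i = j then of_bool (0 < s (eating s P i)) else (0::real))"
    by (intro sum.cong) (auto simp: eats_def)
  also have "\<dots> = of_bool (\<exists>j\<in>D. eats s P i j)"
    using assms by (auto simp: eats_def)
  finally show ?thesis .
qed

text \<open>An agent eats at most one item at a time, so swapping the sums turns the consumption
  rate of \<open>D\<close> into a count of agents.\<close>

lemma sum_rate:
  assumes "finite D"
  shows "(\<Sum>j\<in>D. rate n s P j) = (\<Sum>i<n. of_bool (\<exists>j\<in>D. eats s P i j))"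
  unfolding rate_def by (subst sum.swap) (simp add: sum_eats[OF assms])

section \<open>Eating in continuous time\<close>

text \<open>
  Linearity to the right of each time replaces the phases of the mechanism, so that two runs with
  different phase boundaries can be compared.
\<close>

locale eating_flow =
  fixes n m :: nat and P :: "nat \<Rightarrow> nat list"
    and s :: "real \<Rightarrow> nat \<Rightarrow> real" and a :: "real \<Rightarrow> nat \<Rightarrow> nat \<Rightarrow> real"
  assumes pref: "i < n \<Longrightarrow> is_pref m (P i)"
    and s_init: "j < m \<Longrightarrow> s 0 j = 1"
    and a_init: "i < n \<Longrightarrow> j < m \<Longrightarrow> a 0 i j = 0"
    and s_cont: "j < m \<Longrightarrow> continuous_on {0..} (\<lambda>t. s t j)"
    and a_cont: "i < n \<Longrightarrow> j < m \<Longrightarrow> continuous_on {0..} (\<lambda>t. a t i j)"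
    and local_linear: "0 \<le> t \<Longrightarrow> \<forall>\<^sub>F h in at_right 0. \<forall>j<m.
      s (t + h) j = s t j - h * rate n (s t) P j \<and>
      (\<forall>i<n. a (t + h) i j = a t i j + h * of_bool (eats (s t) P i j))"
begin

lemma set_pref: "i < n \<Longrightarrow> set (P i) = {..<m}"
  using pref by (simp add: is_pref_def)

lemma s_cont_sub: "j < m \<Longrightarrow> 0 \<le> t \<Longrightarrow> continuous_on {t..u} (\<lambda>t. s t j)"
  by (rule continuous_on_subset[OF s_cont]) auto

lemma a_cont_sub: "i < n \<Longrightarrow> j < m \<Longrightarrow> 0 \<le> t \<Longrightarrow> continuous_on {t..u} (\<lambda>t. a t i j)"
  by (rule continuous_on_subset[OF a_cont]) auto

lemma local_linear_pos:
  assumes "0 \<le> t"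
  shows "\<forall>\<^sub>F h in at_right 0. 0 < h \<and> (\<forall>j<m.
      s (t + h) j = s t j - h * rate n (s t) P j \<and>
      (\<forall>i<n. a (t + h) i j = a t i j + h * of_bool (eats (s t) P i j)))"
  using eventually_at_right_less local_linear[OF assms] by (rule eventually_conj)

lemma sum_a_local:
  assumes "0 \<le> t" "i < n" "D \<subseteq> {..<m}"
  shows "\<forall>\<^sub>F h in at_right 0.
    (\<Sum>j\<in>D. a (t + h) i j) = (\<Sum>j\<in>D. a t i j) + h * of_bool (\<exists>j\<in>D. eats (s t) P i j)"
  using local_linear[OF assms(1)]
proof eventually_elim
  case (elim h)
  have "(\<Sum>j\<in>D. a (t + h) i j) = (\<Sum>j\<in>D. a t i j + h * of_bool (eats (s t) P i j))"
    by (intro sum.cong) (use elim assms in auto)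
  then show ?case
    using sum_eats[of D "s t" P i] finite_subset[OF assms(3)]
    by (simp only: sum.distrib finite_lessThan flip: sum_distrib_left)
qed

lemma sum_s_local:
  assumes "0 \<le> t" "D \<subseteq> {..<m}"
  shows "\<forall>\<^sub>F h in at_right 0.
    (\<Sum>j\<in>D. s (t + h) j) = (\<Sum>j\<in>D. s t j) - h * (\<Sum>j\<in>D. rate n (s t) P j)"
  using local_linear[OF assms(1)]
proof eventually_elim
  case (elim h)
  have "(\<Sum>j\<in>D. s (t + h) j) = (\<Sum>j\<in>D. s t j - h * rate n (s t) P j)"
    by (intro sum.cong) (use elim assms in auto)
  then show ?case by (simp only: sum_subtractf sum_distrib_left)
qed

lemma s_antimono:
  assumes "j < m" "0 \<le> t" "t \<le> u"
  shows "s u j \<le> s t j"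
proof -
  have "s u j \<le> s t j + 0 * (u - t)"
  proof (rule le_of_right_slope_le[OF assms(3) s_cont_sub[OF assms(1,2)]])
    fix v assume "t \<le> v" "v < u"
    with assms have "0 \<le> v" by simp
    from local_linear_pos[OF this]
    show "\<forall>\<^sub>F h in at_right 0. s (v + h) j \<le> s v j + 0 * h"
      by eventually_elim (use assms rate_nonneg in auto)
  qed
  then show ?thesis by simp
qed

lemma sum_a_init: "i < n \<Longrightarrow> D \<subseteq> {..<m} \<Longrightarrow> (\<Sum>j\<in>D. a 0 i j) = 0"
  by (intro sum.neutral) (use a_init in auto)

lemma sum_a_cont:
  "i < n \<Longrightarrow> D \<subseteq> {..<m} \<Longrightarrow> 0 \<le> t \<Longrightarrow> continuous_on {t..u} (\<lambda>t. \<Sum>j\<in>D. a t i j)"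
  by (intro continuous_on_sum a_cont_sub) auto

lemma sum_a_le:
  assumes "D \<subseteq> {..<m}" "i < n" "0 \<le> t"
  shows "(\<Sum>j\<in>D. a t i j) \<le> t"
proof -
  have "(\<Sum>j\<in>D. a t i j) \<le> (\<Sum>j\<in>D. a 0 i j) + 1 * (t - 0)"
  proof (rule le_of_right_slope_le[OF assms(3)])
    fix v :: real assume "0 \<le> v" "v < t"
    show "\<forall>\<^sub>F h in at_right 0. (\<Sum>j\<in>D. a (v + h) i j) \<le> (\<Sum>j\<in>D. a v i j) + 1 * h"
      using sum_a_local[OF \<open>0 \<le> v\<close> assms(2,1)] local_linear_pos[OF \<open>0 \<le> v\<close>]
      by eventually_elim simp
  qed (simp add: sum_a_cont assms)
  then show ?thesis by (simp add: sum_a_init assms)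
qed

lemma sum_a_mono:
  assumes "D \<subseteq> {..<m}" "i < n" "0 \<le> t" "t \<le> u"
  shows "(\<Sum>j\<in>D. a t i j) \<le> (\<Sum>j\<in>D. a u i j)"
proof -
  \<comment> \<open>The slope criterion bounds from above; lower bounds come from applying it to the
    negated function.\<close>
  have "- (\<Sum>j\<in>D. a u i j) \<le> - (\<Sum>j\<in>D. a t i j) + 0 * (u - t)"
  proof (rule le_of_right_slope_le[OF assms(4)])
    fix v :: real assume "t \<le> v" "v < u"
    with assms have v: "0 \<le> v" by simp
    show "\<forall>\<^sub>F h in at_right 0. - (\<Sum>j\<in>D. a (v + h) i j) \<le> - (\<Sum>j\<in>D. a v i j) + 0 * h"
      using sum_a_local[OF v assms(2,1)] local_linear_pos[OF v]
      by eventually_elim simp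
  qed (intro continuous_on_minus sum_a_cont assms)
  then show ?thesis by simp
qed

text \<open>While a top item is left, the best available item lies in the top part of the list, so
  the agent eats there at full rate 1. This makes the truthful utility at least
  \<open>T\<close>.\<close>

lemma sum_top_ge:
  assumes "i < n" "0 \<le> T"
    and left: "\<And>t. 0 \<le> t \<Longrightarrow> t < T \<Longrightarrow> \<exists>j\<in>set (take k (P i)). 0 < s t j"
  shows "T \<le> (\<Sum>j\<in>set (take k (P i)). a T i j)"
proof -
  let ?D = "set (take k (P i))"
  have D: "?D \<subseteq> {..<m}" using set_pref[OF assms(1)] set_take_subset by fastforce
  have "- (\<Sum>j\<in>?D. a T i j) \<le> - (\<Sum>j\<in>?D. a 0 i j) + (-1) * (T - 0)"
  proof (rule le_of_right_slope_le[OF assms(2)])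
    fix v :: real assume v: "0 \<le> v" "v < T"
    obtain j where j: "j \<in> ?D" "0 < s v j" using left[OF v] by blast
    obtain ys zs where yz: "take k (P i) = ys @ j # zs" using split_list[OF j(1)] by blast
    then have "P i = ys @ j # (zs @ drop k (P i))"
      by (metis append.assoc append_Cons append_take_drop_id)
    from eating_prefix[of "s v" j P i, OF j(2) this] have eats: "\<exists>j\<in>?D. eats (s v) P i j"
      unfolding yz by (auto simp: eats_def)
    show "\<forall>\<^sub>F h in at_right 0. - (\<Sum>j\<in>?D. a (v + h) i j) \<le> - (\<Sum>j\<in>?D. a v i j) + (-1) * h"
      using sum_a_local[OF v(1) assms(1) D]
      by eventually_elim (use eats in simp)
  qed (intro continuous_on_minus sum_a_cont assms order_refl D)
  then show ?thesis by (simp add: sum_a_init assms D)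
qed

text \<open>Agent 0 alone would eat at most \<open>T\<close> of the item by time \<open>T\<close>,
  leaving at least \<open>1 - T > 0\<close>.\<close>

lemma exhausted_by_another:
  assumes "j < m" "s T j \<le> 0" "0 \<le> T" "T < 1"
  obtains i t where "0 < i" "i < n" "0 \<le> t" "t < T" "eats (s t) P i j"
proof (rule ccontr)
  assume "\<not> thesis"
  with that have none: "\<not> eats (s t) P i j" if "0 < i" "i < n" "0 \<le> t" "t < T" for i t
    using that by blast
  have "- s T j \<le> - s 0 j + 1 * (T - 0)"
  proof (rule le_of_right_slope_le[OF assms(3)])
    fix v :: real assume v: "0 \<le> v" "v < T"
    have "rate n (s v) P j \<le> (\<Sum>i<n. of_bool (i = 0))"
      unfolding rate_def using none[OF _ _ v] by (intro sum_mono) auto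
    also have "\<dots> \<le> 1" by (simp add: of_bool_def)
    finally have le1: "rate n (s v) P j \<le> 1" .
    show "\<forall>\<^sub>F h in at_right 0. - s (v + h) j \<le> - s v j + 1 * h"
      using local_linear_pos[OF v(1)]
    proof eventually_elim
      case (elim h)
      then have "h * rate n (s v) P j \<le> h * 1" using le1 by (intro mult_left_mono) auto
      with elim assms(1) show ?case by simp
    qed
  qed (intro continuous_on_minus s_cont_sub assms order_refl)
  with s_init[OF assms(1)] assms show False by simp
qed

end

section \<open>Comparison of two reports\<close>

lemma surplus_le:
  fixes sA sB :: "real \<Rightarrow> nat \<Rightarrow> real"
  assumes "eating_flow n m P sA aA" "eating_flow n m Q sB aB"
    and same: "\<And>i. 0 < i \<Longrightarrow> i < n \<Longrightarrow> Q i = P i" and "0 \<le> T"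
  shows "(\<Sum>j<m. max 0 (sB T j - sA T j)) \<le> T"
proof -
  interpret A: eating_flow n m P sA aA by fact
  interpret B: eating_flow n m Q sB aB by fact
  let ?W = "\<lambda>t. \<Sum>j<m. max 0 (sB t j - sA t j)"
  have "?W T \<le> ?W 0 + 1 * (T - 0)"
  proof (rule le_of_right_slope_le[OF assms(4)])
    show "continuous_on {0..T} ?W"
      by (intro continuous_intros A.s_cont_sub B.s_cont_sub) auto
    fix t :: real assume t: "0 \<le> t" "t < T"
    \<comment> \<open>Strictly different stocks keep their order for small \<open>h\<close>; only
      ties at \<open>t\<close> may break either way.\<close>
    have "\<forall>\<^sub>F h in at_right 0. \<forall>j\<in>{..<m}.
        (sB t j < sA t j \<longrightarrow> sB t j - h * rate n (sB t) Q j < sA t j - h * rate n (sA t) P j) \<and>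
        (sA t j < sB t j \<longrightarrow> sA t j - h * rate n (sA t) P j < sB t j - h * rate n (sB t) Q j)"
      by (intro eventually_ball_finite ballI eventually_conj finite_lessThan)
        (auto simp: eventually_linear_less)
    then show "\<forall>\<^sub>F h in at_right 0. ?W (t + h) \<le> ?W t + 1 * h"
      using A.local_linear_pos[OF t(1)] B.local_linear_pos[OF t(1)]
    proof eventually_elim
      case (elim h)
      \<comment> \<open>\<open>D\<close> is read off just after \<open>t\<close>, so it includes
        ties about to become a surplus. It contains every strict surplus at \<open>t\<close> and no
        strict deficit, and on it the positive parts are plain differences.\<close>
      define D where "D = {j. j < m \<and> sA (t + h) j < sB (t + h) j}"
      have Dm: "D \<subseteq> {..<m}" "finite D" by (auto simp: D_def)
      have DI: "j \<in> D" if "j < m" "sA t j < sB t j" for j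
        using elim that by (auto simp: D_def)
      have Dle: "sA t j \<le> sB t j" if "j \<in> D" for j
      proof (rule ccontr)
        assume "\<not> sA t j \<le> sB t j"
        then have "sB (t + h) j < sA (t + h) j" using elim that by (auto simp: D_def)
        with that show False by (simp add: D_def)
      qed
      have "?W (t + h) = (\<Sum>j\<in>D. sB (t + h) j - sA (t + h) j)"
        by (rule sum.mono_neutral_cong_right) (auto simp: D_def max_def)
      also have "\<dots> = (\<Sum>j\<in>D. (sB t j - sA t j) + h * (rate n (sA t) P j - rate n (sB t) Q j))"
        by (intro sum.cong) (use elim in \<open>auto simp: D_def algebra_simps\<close>)
      also have "\<dots> = (\<Sum>j\<in>D. sB t j - sA t j)
          + h * ((\<Sum>j\<in>D. rate n (sA t) P j) - (\<Sum>j\<in>D. rate n (sB t) Q j))"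
        by (simp only: sum.distrib sum_subtractf flip: sum_distrib_left)
      also have "\<dots> \<le> ?W t + h * 1"
      proof (intro add_mono mult_left_mono)
        have "(\<Sum>j\<in>D. sB t j - sA t j) \<le> (\<Sum>j\<in>D. max 0 (sB t j - sA t j))"
          by (intro sum_mono) auto
        also have "\<dots> \<le> ?W t" by (intro sum_mono2) (use Dm in auto)
        finally show "(\<Sum>j\<in>D. sB t j - sA t j) \<le> ?W t" .
        \<comment> \<open>In run B such an agent eats the same item or one exhausted in A but
          available in B; the latter has a strict surplus at \<open>t\<close>, so it belongs to
          \<open>D\<close>.\<close>
        have "\<exists>j\<in>D. eats (sB t) Q i j" if i: "0 < i" "i < n" and ex: "\<exists>j\<in>D. eats (sA t) P i j" for i
        proof -
          obtain x where x: "x \<in> D" "0 < sA t x" "eating (sA t) P i = x"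
            using ex by (auto simp: eats_def)
          have "x \<in> set (P i)" using x(1) A.set_pref[OF i(2)] by (auto simp: D_def)
          moreover have "0 < sB t x" using Dle[OF x(1)] x(2) by simp
          ultimately have "0 < sB t (eating (sB t) Q i)" "eating (sB t) Q i \<in> set (P i)"
            "eating (sB t) Q i = x \<or> sA t (eating (sB t) Q i) \<le> 0"
            using eating_compare[of "sA t" P i x "sB t" Q, OF x(3,2) _ _ same[OF i]] by blast+
          moreover from this have "eating (sB t) Q i \<in> D"
            using x(1) DI A.set_pref[OF i(2)] by force
          ultimately show ?thesis by (auto simp: eats_def)
        qed
        \<comment> \<open>The term \<open>of_bool (i = 0)\<close> pays for agent 0, whose two
          reports may differ.\<close>
        then have "(\<Sum>j\<in>D. rate n (sA t) P j)
            \<le> (\<Sum>i<n. of_bool (\<exists>j\<in>D. eats (sB t) Q i j) + of_bool (i = 0))"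
          unfolding sum_rate[OF Dm(2)] by (intro sum_mono) auto
        also have "\<dots> \<le> (\<Sum>j\<in>D. rate n (sB t) Q j) + 1"
          unfolding sum_rate[OF Dm(2)] by (simp add: sum.distrib of_bool_def)
        finally show "(\<Sum>j\<in>D. rate n (sA t) P j) - (\<Sum>j\<in>D. rate n (sB t) Q j) \<le> 1" by simp
      qed (use elim in auto)
      finally show ?case by simp
    qed
  qed
  moreover have "?W 0 = 0"
    by (intro sum.neutral) (simp add: A.s_init B.s_init)
  ultimately show ?thesis by simp
qed

lemma manipulation_bound:
  fixes sA sB :: "real \<Rightarrow> nat \<Rightarrow> real"
  assumes "eating_flow n m P sA aA" "eating_flow n m Q sB aB"
    and same: "\<And>i. 0 < i \<Longrightarrow> i < n \<Longrightarrow> Q i = P i"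
    and "0 < n" and T: "0 \<le> T" "T < 1" "T \<le> N"
    and D: "D \<subseteq> {..<m}" and exhausted: "\<And>j. j \<in> D \<Longrightarrow> sA T j \<le> 0"
    and final: "\<And>j. j < m \<Longrightarrow> 0 \<le> sB N j"
  shows "(\<Sum>j\<in>D. aB N 0 j) \<le> 3/2 * T"
proof -
  interpret A: eating_flow n m P sA aA by fact
  interpret B: eating_flow n m Q sB aB by fact
  define X where "X = {j. j < m \<and> sA T j \<le> 0}"
  have X: "X \<subseteq> {..<m}" "finite X" and DX: "D \<subseteq> X"
    using D exhausted by (auto simp: X_def)
  \<comment> \<open>A potential that does not increase after \<open>T\<close>: gains have weight 2
    because agent 0 eats from \<open>D\<close> only while \<open>X\<close> shrinks at rate at least
    2.\<close>
  let ?f = "\<lambda>t. 2 * (\<Sum>j\<in>D. aB t 0 j) + (\<Sum>j\<in>X. sB t j)"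
  have "?f N \<le> ?f T + 0 * (N - T)"
  proof (rule le_of_right_slope_le[OF T(3)])
    show "continuous_on {T..N} ?f"
      by (intro continuous_intros B.sum_a_cont B.s_cont_sub) (use assms X in auto)
    fix t assume "T \<le> t" "t < N"
    with T have t: "0 \<le> t" by simp
    have two: "2 * of_bool (\<exists>j\<in>D. eats (sB t) Q 0 j) \<le> (\<Sum>j\<in>X. rate n (sB t) Q j)"
    proof (cases "\<exists>j\<in>D. eats (sB t) Q 0 j")
      case True
      then obtain j where j: "j \<in> D" "eats (sB t) Q 0 j" by blast
      then have jm: "j < m" "0 < sB t j" using D by (auto simp: eats_def)
      obtain i u where i: "0 < i" "i < n" and u: "0 \<le> u" "u < T" "eats (sA u) P i j"
        using A.exhausted_by_another[OF jm(1) exhausted[OF j(1)] T(1,2)] by blast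
      have "j \<in> set (P i)" using jm A.set_pref[OF i(2)] by simp
      then have y: "0 < sB t (eating (sB t) Q i)" "eating (sB t) Q i \<in> set (P i)"
        "eating (sB t) Q i = j \<or> sA u (eating (sB t) Q i) \<le> 0"
        using eating_compare[of "sA u" P i j "sB t" Q, OF _ _ _ jm(2) same[OF i]] u(3)
        unfolding eats_def by blast+
      then have "eating (sB t) Q i < m" using A.set_pref[OF i(2)] by simp
      \<comment> \<open>Agent \<open>i\<close> ate \<open>j\<close> in run A at time
        \<open>u\<close>, so in B it eats \<open>j\<close> or an item exhausted in A by time
        \<open>u\<close>. Stocks never grow, so that item is exhausted at \<open>T\<close> too and
        lies in \<open>X\<close>.\<close>
      moreover have "sA T (eating (sB t) Q i) \<le> 0"
        using y(3) exhausted[OF j(1)] A.s_antimono[OF calculation u(1), of T] u(2) by auto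
      ultimately have "\<exists>j\<in>X. eats (sB t) Q i j" using y(1) by (auto simp: X_def eats_def)
      moreover have "\<exists>j\<in>X. eats (sB t) Q 0 j" using True DX by blast
      ultimately have "(\<Sum>i\<in>{0, i}. of_bool (\<exists>j\<in>X. eats (sB t) Q i j)) = (2::real)"
        using i by simp
      moreover have "(\<Sum>i\<in>{0, i}. of_bool (\<exists>j\<in>X. eats (sB t) Q i j))
          \<le> (\<Sum>i<n. of_bool (\<exists>j\<in>X. eats (sB t) Q i j) :: real)"
        by (intro sum_mono2) (use i in auto)
      ultimately show ?thesis using True by (simp add: sum_rate[OF X(2)])
    qed (simp add: sum_nonneg rate_nonneg)
    show "\<forall>\<^sub>F h in at_right 0. ?f (t + h) \<le> ?f t + 0 * h"
      using B.local_linear_pos[OF t] B.sum_a_local[OF t \<open>0 < n\<close> D] B.sum_s_local[OF t X(1)]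
    proof eventually_elim
      case (elim h)
      then have "h * (2 * of_bool (\<exists>j\<in>D. eats (sB t) Q 0 j)) \<le> h * (\<Sum>j\<in>X. rate n (sB t) Q j)"
        using two by (intro mult_left_mono) auto
      then show ?case unfolding elim(2,3) by simp
    qed
  qed
  moreover have "(\<Sum>j\<in>D. aB T 0 j) \<le> T"
    by (rule B.sum_a_le[OF D \<open>0 < n\<close> T(1)])
  moreover have "(\<Sum>j\<in>X. sB T j) \<le> T"
  proof -
    \<comment> \<open>On \<open>X\<close> the stock of A is at most 0, so the stock of B is at most
      its surplus.\<close>
    have "(\<Sum>j\<in>X. sB T j) \<le> (\<Sum>j\<in>X. max 0 (sB T j - sA T j))"
      by (intro sum_mono) (auto simp: X_def)
    also have "\<dots> \<le> (\<Sum>j<m. max 0 (sB T j - sA T j))"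
      by (intro sum_mono2) (use X in auto)
    also have "\<dots> \<le> T" by (rule surplus_le[OF assms(1,2) same T(1)])
    finally show ?thesis .
  qed
  moreover have "0 \<le> (\<Sum>j\<in>X. sB N j)"
    by (intro sum_nonneg final) (auto simp: X_def)
  \<comment> \<open>Twice the final gain is at most \<open>?f N\<close>, hence at most
    \<open>?f T\<close>, which is at most \<open>2 * T + T\<close>.\<close>
  ultimately show ?thesis by simp
qed

section \<open>The mechanism as a continuous-time process\<close>

locale ps_process =
  fixes n m :: nat and P :: "nat \<Rightarrow> nat list"
  assumes agents: "0 < n" and prefs: "i < n \<Longrightarrow> is_pref m (P i)"
begin

definition state :: "nat \<Rightarrow> ps_state" where
  "state l = (ps_step n m P ^^ l) (0, (\<lambda>j. 1), (\<lambda>i j. 0), (\<lambda>j. 0))"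

definition time :: "nat \<Rightarrow> real" where "time l = fst (state l)"

definition stock :: "nat \<Rightarrow> nat \<Rightarrow> real" where "stock l = fst (snd (state l))"

definition share :: "nat \<Rightarrow> nat \<Rightarrow> nat \<Rightarrow> real" where "share l = fst (snd (snd (state l)))"

definition exh :: "nat \<Rightarrow> nat \<Rightarrow> real" where "exh l = snd (snd (snd (state l)))"

text \<open>Length 0 matches \<open>ps_step\<close> leaving a finished state unchanged, so the
  equations in \<open>phase\<close> hold without a case distinction.\<close>

definition len :: "nat \<Rightarrow> real" where
  "len l = (if avail m (stock l) = {} then 0 else step_len n m (stock l) P)"

lemma init: "time 0 = 0" "stock 0 j = 1" "share 0 i j = 0"
  by (simp_all add: state_def time_def stock_def share_def)

lemma state_Suc: "state (Suc l) = ps_step n m P (time l, stock l, share l, exh l)"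
  by (simp add: state_def time_def stock_def share_def exh_def)

lemma phase:
  shows time_Suc: "time (Suc l) = time l + len l"
    and stock_Suc: "j < m \<Longrightarrow> stock (Suc l) j = stock l j - len l * rate n (stock l) P j"
    and share_Suc: "i < n \<Longrightarrow> j < m \<Longrightarrow>
      share (Suc l) i j = share l i j + len l * of_bool (eats (stock l) P i j)"
    and exh_Suc: "j < m \<Longrightarrow> exh (Suc l) j =
      (if 0 < stock l j \<and> stock (Suc l) j = 0 then time (Suc l) else exh l j)"
  unfolding time_def[of "Suc l"] stock_def[of "Suc l"] share_def[of "Suc l"] exh_def[of "Suc l"]
    state_Suc
  by (auto simp: ps_step_def len_def rate_eq_eaters eats_def Let_def avail_def)

text \<open>Agent 0 ranks all items, so it eats an available one as long as any is left. Hence the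
  \<open>Min\<close> in \<open>step_len\<close> ranges over a nonempty set.\<close>

lemma someone_eats:
  assumes "j < m" "0 < stock l j"
  shows "\<exists>j\<in>avail m (stock l). 0 < eaters n (stock l) P j"
proof -
  have set: "set (P 0) = {..<m}" using prefs[OF agents] by (simp add: is_pref_def)
  with assms(1) have "j \<in> set (P 0)" by simp
  then obtain ys zs where yz: "P 0 = ys @ j # zs" by (meson split_list)
  let ?x = "eating (stock l) P 0"
  have "?x \<in> avail m (stock l)"
    using eating_prefix[of "stock l" j P 0, OF assms(2) yz] set assms(1)
    unfolding yz by (auto simp: avail_def)
  moreover have "0 < eaters n (stock l) P ?x"
    unfolding eaters_def using agents by (auto simp: card_gt_0_iff)
  ultimately show ?thesis by blast
qed

text \<open>The minimum is attained, and an item attaining it runs out exactly at the end of the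
  phase; minimality keeps the others from being overdrawn.\<close>

lemma phase_len:
  assumes "avail m (stock l) \<noteq> {}"
  shows "0 < len l"
    and "\<exists>j\<in>avail m (stock l). stock (Suc l) j = 0"
    and "j \<in> avail m (stock l) \<Longrightarrow> 0 < eaters n (stock l) P j \<Longrightarrow>
      len l \<le> stock l j / eaters n (stock l) P j"
proof -
  define S where "S = {stock l j / real (eaters n (stock l) P j) | j.
    j \<in> avail m (stock l) \<and> 0 < eaters n (stock l) P j}"
  have len: "len l = Min S" using assms by (simp add: len_def step_len_def S_def)
  have fin: "finite S"
    unfolding S_def by (rule finite_image_set) (simp add: avail_def)
  have "S \<noteq> {}"
    using someone_eats assms by (fastforce simp: S_def avail_def)
  then have "len l \<in> S" unfolding len using fin by simp
  then obtain j where j: "j \<in> avail m (stock l)" "0 < eaters n (stock l) P j"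
    "len l = stock l j / eaters n (stock l) P j" by (auto simp: S_def)
  then show "0 < len l" by (simp add: avail_def)
  have "stock (Suc l) j = 0"
    using j by (simp add: stock_Suc avail_def rate_eq_eaters)
  with j(1) show "\<exists>j\<in>avail m (stock l). stock (Suc l) j = 0" by blast
  show "len l \<le> stock l j / eaters n (stock l) P j"
    if "j \<in> avail m (stock l)" "0 < eaters n (stock l) P j" for j
    unfolding len by (rule Min_le[OF fin]) (use that in \<open>auto simp: S_def\<close>)
qed

lemma len_nonneg: "0 \<le> len l"
  using phase_len(1)[of l] by (cases "avail m (stock l) = {}") (auto simp: len_def)

lemma len_rate_le:
  assumes "j < m" "0 \<le> stock l j"
  shows "len l * rate n (stock l) P j \<le> stock l j"
proof (cases "0 < rate n (stock l) P j")
  case True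
  then have "j \<in> avail m (stock l)" "0 < eaters n (stock l) P j"
    using assms by (auto simp: rate_eq_eaters avail_def split: if_splits)
  with phase_len(3)[of l j] show ?thesis
    by (auto simp: rate_eq_eaters avail_def field_simps)
qed (use rate_nonneg[of n "stock l" P j] assms in auto)

lemma stock_nonneg: "j < m \<Longrightarrow> 0 \<le> stock l j"
  by (induction l) (auto simp: init stock_Suc len_rate_le)

lemma time_mono: "l \<le> p \<Longrightarrow> time l \<le> time p"
  by (rule lift_Suc_mono_le[of time]) (auto simp: time_Suc len_nonneg)

lemma stock_mono: "j < m \<Longrightarrow> l \<le> p \<Longrightarrow> stock p j \<le> stock l j"
  by (rule lift_Suc_antimono_le[of "\<lambda>l. stock l j"])
    (auto simp: stock_Suc len_nonneg rate_nonneg)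

text \<open>Each phase with items left exhausts at least one, and stocks never grow. Hence
  \<open>m\<close> phases suffice.\<close>

lemma card_avail: "card (avail m (stock l)) \<le> m - l"
proof (induction l)
  case 0
  then show ?case by (simp add: avail_def init)
next
  case (Suc l)
  have fin: "finite (avail m (stock l))" by (simp add: avail_def)
  have sub: "avail m (stock (Suc l)) \<subseteq> avail m (stock l)"
    using stock_mono[of _ l "Suc l"] by (force simp: avail_def)
  show ?case
  proof (cases "avail m (stock l) = {}")
    case False
    obtain j where j: "j \<in> avail m (stock l)" "stock (Suc l) j = 0"
      using phase_len(2)[OF False] by blast
    then have "j \<notin> avail m (stock (Suc l))" by (simp add: avail_def)
    with sub j(1) have "avail m (stock (Suc l)) \<subset> avail m (stock l)" by blast
    from psubset_card_mono[OF fin this] Suc show ?thesis by simp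
  next
    case True
    with sub have "avail m (stock (Suc l)) = {}" by simp
    then show ?thesis by simp
  qed
qed

lemma all_exhausted: "j < m \<Longrightarrow> stock m j = 0"
  using card_avail[of m] stock_nonneg[of j m] by (force simp: avail_def)

text \<open>An entry of \<open>exh\<close> is written only in a phase that starts with positive
  stock, so the time of exhaustion is never overwritten later.\<close>

lemma exh_phase:
  assumes "j < m" "stock l j = 0"
  shows "\<exists>p<l. exh l j = time (Suc p) \<and> 0 < stock p j \<and> stock (Suc p) j = 0"
  using assms
proof (induction l)
  case 0
  then show ?case by (simp add: init)
next
  case (Suc l)
  show ?case
  proof (cases "stock l j = 0")
    case True
    with Suc obtain p where "p < l" "exh l j = time (Suc p)" "0 < stock p j" "stock (Suc p) j = 0"
      by blast
    then show ?thesis using True Suc.prems by (intro exI[of _ p]) (simp add: exh_Suc)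
  next
    case False
    then have "0 < stock l j" using stock_nonneg[OF Suc.prems(1), of l] by simp
    then show ?thesis using Suc.prems by (intro exI[of _ l]) (simp add: exh_Suc)
  qed
qed

section \<open>Linear interpolation between the phases\<close>

definition elapsed :: "nat \<Rightarrow> real \<Rightarrow> real" where
  "elapsed l t = max 0 (min t (time (Suc l)) - time l)"

text \<open>\<open>elapsed l t\<close> is the part of phase \<open>l\<close> that lies before
  \<open>t\<close>. Summing these clamped lengths over all phases makes continuity in
  \<open>t\<close> immediate, with no gluing at the boundaries.\<close>

definition stock_at :: "real \<Rightarrow> nat \<Rightarrow> real" where
  "stock_at t j = 1 - (\<Sum>l<m. elapsed l t * rate n (stock l) P j)"

definition share_at :: "real \<Rightarrow> nat \<Rightarrow> nat \<Rightarrow> real" where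
  "share_at t i j = (\<Sum>l<m. elapsed l t * of_bool (eats (stock l) P i j))"

text \<open>Phases before \<open>p\<close> count in full and later ones vanish. The arbitrary
  weights \<open>c\<close> cover stocks and shares alike.\<close>

lemma sum_elapsed:
  assumes "p < m" "time p \<le> t" "t \<le> time (Suc p)"
  shows "(\<Sum>l<m. elapsed l t * c l) = (\<Sum>l<p. len l * c l) + (t - time p) * c p"
proof -
  have "(\<Sum>l<m. elapsed l t * c l) = (\<Sum>l<Suc p. elapsed l t * c l)"
  proof (rule sum.mono_neutral_right)
    show "\<forall>l\<in>{..<m} - {..<Suc p}. elapsed l t * c l = 0"
    proof
      fix l assume "l \<in> {..<m} - {..<Suc p}"
      then have "time (Suc p) \<le> time l" by (intro time_mono) auto
      with assms show "elapsed l t * c l = 0" by (simp add: elapsed_def)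
    qed
  qed (use assms in auto)
  also have "\<dots> = (\<Sum>l<p. elapsed l t * c l) + elapsed p t * c p" by simp
  also have "elapsed p t = t - time p" using assms by (simp add: elapsed_def)
  also have "(\<Sum>l<p. elapsed l t * c l) = (\<Sum>l<p. len l * c l)"
  proof (rule sum.cong)
    fix l assume "l \<in> {..<p}"
    then have "time (Suc l) \<le> time p" by (intro time_mono) auto
    with assms show "elapsed l t * c l = len l * c l"
      using len_nonneg[of l] by (simp add: elapsed_def time_Suc)
  qed simp
  finally show ?thesis .
qed

lemma sum_elapsed_end:
  assumes "time m \<le> t"
  shows "(\<Sum>l<m. elapsed l t * c l) = (\<Sum>l<m. len l * c l)"
proof (rule sum.cong)
  fix l assume "l \<in> {..<m}"
  then have "time (Suc l) \<le> time m" by (intro time_mono) auto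
  with assms show "elapsed l t * c l = len l * c l"
    using len_nonneg[of l] by (simp add: elapsed_def time_Suc)
qed simp

lemma stock_sum: "j < m \<Longrightarrow> stock p j = 1 - (\<Sum>l<p. len l * rate n (stock l) P j)"
  by (induction p) (simp_all add: init stock_Suc)

lemma share_sum:
  "i < n \<Longrightarrow> j < m \<Longrightarrow> share p i j = (\<Sum>l<p. len l * of_bool (eats (stock l) P i j))"
  by (induction p) (simp_all add: init share_Suc)

lemma stock_at_phase:
  assumes "p < m" "time p \<le> t" "t \<le> time (Suc p)" "j < m"
  shows "stock_at t j = stock p j - (t - time p) * rate n (stock p) P j"
  by (simp add: stock_at_def sum_elapsed[OF assms(1-3)] stock_sum[OF assms(4)])

lemma share_at_phase:
  assumes "p < m" "time p \<le> t" "t \<le> time (Suc p)" "i < n" "j < m"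
  shows "share_at t i j = share p i j + (t - time p) * of_bool (eats (stock p) P i j)"
  by (simp add: share_at_def sum_elapsed[OF assms(1-3)] share_sum[OF assms(4,5)])

lemma stock_at_end: "time m \<le> t \<Longrightarrow> j < m \<Longrightarrow> stock_at t j = 0"
  using stock_sum[of j m] by (simp add: stock_at_def sum_elapsed_end all_exhausted)

lemma share_at_end: "time m \<le> t \<Longrightarrow> i < n \<Longrightarrow> j < m \<Longrightarrow> share_at t i j = share m i j"
  by (simp only: share_at_def sum_elapsed_end share_sum)

text \<open>The strict upper bound leaves room to the right of \<open>t\<close> within the same
  phase, as one-sided linearity requires.\<close>

lemma phase_cases:
  assumes "0 \<le> t"
  obtains "time m \<le> t" | p where "p < m" "time p \<le> t" "t < time (Suc p)"
proof (cases "time m \<le> t")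
  case False
  have "\<exists>p<q. time p \<le> t \<and> t < time (Suc p)" if "t < time q" for q
    using that
  proof (induction q)
    case 0
    with assms show ?case by (simp add: init)
  next
    case (Suc q)
    then show ?case by (cases "t < time q") (auto simp: less_Suc_eq)
  qed
  with False that show ?thesis by (meson not_le)
qed (use that in blast)

text \<open>An item can run out only at the end of a phase, so the available items, and with them
  all choices, are constant during it.\<close>

lemma stock_at_pos_iff:
  assumes "p < m" "time p \<le> t" "t < time (Suc p)" "j < m"
  shows "0 < stock_at t j \<longleftrightarrow> 0 < stock p j"
proof (cases "0 < rate n (stock p) P j")
  case True
  then have "(t - time p) * rate n (stock p) P j < len p * rate n (stock p) P j"
    using assms by (intro mult_strict_right_mono) (auto simp: time_Suc)
  also have "\<dots> \<le> stock p j"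
    by (intro len_rate_le stock_nonneg assms)
  finally have "0 < stock_at t j" using assms by (simp add: stock_at_phase)
  moreover have "0 < stock p j" using True by (auto simp: rate_eq_eaters split: if_splits)
  ultimately show ?thesis by simp
next
  case False
  then have "rate n (stock p) P j = 0" using rate_nonneg[of n "stock p" P j] by simp
  then show ?thesis using assms by (simp add: stock_at_phase)
qed

lemma eating_cong:
  assumes "i < n" "\<And>j. j < m \<Longrightarrow> 0 < s j \<longleftrightarrow> 0 < s' j"
  shows "eating s P i = eating s' P i"
proof -
  have "filter (\<lambda>j. 0 < s j) (P i) = filter (\<lambda>j. 0 < s' j) (P i)"
    by (rule filter_cong) (use assms prefs[OF assms(1)] in \<open>auto simp: is_pref_def\<close>)
  then show ?thesis by (simp add: eating_def)
qed

lemma eats_cong: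
  assumes "i < n" "j < m" "\<And>j. j < m \<Longrightarrow> 0 < s j \<longleftrightarrow> 0 < s' j"
  shows "eats s P i j \<longleftrightarrow> eats s' P i j"
  using eating_cong[OF assms(1,3)] assms(2,3) by (simp add: eats_def)

lemma rate_cong:
  assumes "j < m" "\<And>j. j < m \<Longrightarrow> 0 < s j \<longleftrightarrow> 0 < s' j"
  shows "rate n s P j = rate n s' P j"
  unfolding rate_def using eats_cong[OF _ assms] by (intro sum.cong) auto

lemma eating_flow: "eating_flow n m P stock_at share_at"
proof
  have time_nonneg: "0 \<le> time l" for l using time_mono[of 0 l] by (simp add: init)
  have elapsed_0: "elapsed l 0 = 0" for l using time_nonneg[of l] by (simp add: elapsed_def)
  show "stock_at 0 j = 1" for j by (simp add: stock_at_def elapsed_0)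
  show "share_at 0 i j = 0" for i j by (simp add: share_at_def elapsed_0)
  show "continuous_on {0..} (\<lambda>t. stock_at t j)" for j
    unfolding stock_at_def elapsed_def by (intro continuous_intros)
  show "continuous_on {0..} (\<lambda>t. share_at t i j)" for i j
    unfolding share_at_def elapsed_def by (intro continuous_intros)
  fix t :: real assume "0 \<le> t"
  then show "\<forall>\<^sub>F h in at_right 0. \<forall>j<m.
      stock_at (t + h) j = stock_at t j - h * rate n (stock_at t) P j \<and>
      (\<forall>i<n. share_at (t + h) i j = share_at t i j + h * of_bool (eats (stock_at t) P i j))"
  proof (cases rule: phase_cases)
    case 1
    \<comment> \<open>After the last phase all stocks are 0, so no agent \<open>eats\<close>
      anything and the flow is constant.\<close>
    show ?thesis
      using eventually_at_right_less[of "0::real"]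
      by eventually_elim
        (use 1 in \<open>simp add: stock_at_end share_at_end rate_eq_eaters eats_def\<close>)
  next
    case (2 p)
    have "\<forall>\<^sub>F h in at_right 0. h < time (Suc p) - t"
      using 2 by (intro order_tendstoD[of "\<lambda>h. h"] tendsto_ident_at) auto
    then show ?thesis
      using eventually_at_right_less[of "0::real"]
    proof eventually_elim
      case (elim h)
      have pos: "0 < stock_at t j \<longleftrightarrow> 0 < stock p j" if "j < m" for j
        using stock_at_pos_iff 2 that by blast
      show ?case
        using 2 elim eats_cong[OF _ _ pos] rate_cong[OF _ pos]
        by (simp add: stock_at_phase share_at_phase algebra_simps)
    qed
  qed
qed (fact prefs)

section \<open>Allocations and exhaustion times in terms of the flow\<close>

lemma ps_alloc_eq_share: "ps_alloc n m P = share m"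
  by (simp add: ps_alloc_def ps_run_def share_def state_def)

lemma ps_exh_eq_exh: "ps_exh n m P = exh m"
  by (simp add: ps_exh_def ps_run_def exh_def state_def)

lemma ps_exh_props:
  assumes "j < m"
  shows "0 \<le> ps_exh n m P j" "ps_exh n m P j \<le> time m" "stock_at (ps_exh n m P j) j = 0"
    and "0 \<le> t \<Longrightarrow> t < ps_exh n m P j \<Longrightarrow> 0 < stock_at t j"
proof -
  obtain p where p: "p < m" "exh m j = time (Suc p)" "0 < stock p j" "stock (Suc p) j = 0"
    using exh_phase[OF assms all_exhausted[OF assms]] by blast
  note e = p(2)[folded ps_exh_eq_exh]
  show "0 \<le> ps_exh n m P j" using time_mono[of 0 "Suc p"] by (simp add: e init)
  show le: "ps_exh n m P j \<le> time m" unfolding e by (intro time_mono) (use p in simp)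
  show "stock_at (ps_exh n m P j) j = 0"
    using p assms len_nonneg[of p] by (simp add: e stock_at_phase time_Suc stock_Suc)
  assume t: "0 \<le> t" "t < ps_exh n m P j"
  from t(1) show "0 < stock_at t j"
  proof (cases rule: phase_cases)
    case 1
    with t(2) le show ?thesis by simp
  next
    case (2 q)
    have "q \<le> p"
    proof (rule ccontr)
      assume "\<not> q \<le> p"
      then have "time (Suc p) \<le> time q" by (intro time_mono) simp
      with 2 t(2) show False by (simp add: e)
    qed
    then have "0 < stock q j" using stock_mono[OF assms, of q p] p(3) by simp
    with stock_at_pos_iff[OF 2 assms] show ?thesis by simp
  qed
qed

end

section \<open>The bound for the mechanism\<close>

theorem theorem2:
  fixes n m k :: nat and P :: "nat \<Rightarrow> nat list" and P' :: "nat list"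
  assumes "m \<le> n" and "1 \<le> k" and "k \<le> m"
    and "\<forall>i<n. is_pref m (P i)"
    and "is_pref m P'"
    and "1/2 \<le> Max (ps_exh n m P ` set (take k (P 0)))"
    and "Max (ps_exh n m P ` set (take k (P 0))) < 2/3"
  shows "(\<Sum>j\<in>set (take k (P 0)). ps_alloc n m (P(0 := P')) 0 j)
           \<le> 3/2 * (\<Sum>j\<in>set (take k (P 0)). ps_alloc n m P 0 j)"
proof -
  let ?Q = "P(0 := P')" and ?D = "set (take k (P 0))"
  define T where "T = Max (ps_exh n m P ` ?D)"
  have n: "0 < n" using assms by linarith
  interpret A: ps_process n m P
    by standard (use n assms in auto)
  interpret B: ps_process n m ?Q
    by standard (use n assms in auto)
  interpret FA: eating_flow n m P A.stock_at A.share_at by (rule A.eating_flow)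
  have P0: "set (P 0) = {..<m}" by (rule FA.set_pref[OF n])
  then have D: "?D \<subseteq> {..<m}" using set_take_subset by fastforce
  have "0 \<in> set (P 0)" unfolding P0 using assms(2,3) by simp
  then have "P 0 \<noteq> []" by auto
  then have D_ne: "?D \<noteq> {}" using assms by simp
  have "T \<in> ps_exh n m P ` ?D"
    unfolding T_def using D_ne by (intro Max_in) auto
  \<comment> \<open>A top item attaining the maximum is available at all times before
    \<open>T\<close>; it is the witness that \<open>sum_top_ge\<close> asks for.\<close>
  then obtain j where j: "j \<in> ?D" "T = ps_exh n m P j" by blast
  then have jm: "j < m" using D by auto
  have T: "0 \<le> T" "T \<le> A.time m" using A.ps_exh_props[OF jm] j by auto
  have exhausted: "A.stock_at T x \<le> 0" if "x \<in> ?D" for x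
  proof -
    have "ps_exh n m P x \<le> T" unfolding T_def using that by (intro Max_ge) auto
    moreover have xm: "x < m" using that D by auto
    ultimately show ?thesis
      using FA.s_antimono[OF xm, of "ps_exh n m P x" T] A.ps_exh_props[OF xm] by simp
  qed
  have "T \<le> (\<Sum>j\<in>?D. A.share_at T 0 j)"
    by (rule FA.sum_top_ge[OF n T(1)]) (use A.ps_exh_props(4)[OF jm] j in auto)
  also have "\<dots> \<le> (\<Sum>j\<in>?D. A.share_at (A.time m) 0 j)"
    by (rule FA.sum_a_mono[OF D n T])
  also have "\<dots> = (\<Sum>j\<in>?D. ps_alloc n m P 0 j)"
    unfolding A.ps_alloc_eq_share by (intro sum.cong) (use D n A.share_at_end in auto)
  finally have truthful: "T \<le> (\<Sum>j\<in>?D. ps_alloc n m P 0 j)" .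
  \<comment> \<open>Shares are constant from \<open>B.time m\<close> on, so at \<open>N\<close> they
    equal the final allocation; the maximum also secures \<open>T \<le> N\<close>.\<close>
  define N where "N = max T (B.time m)"
  have "(\<Sum>j\<in>?D. ps_alloc n m ?Q 0 j) = (\<Sum>j\<in>?D. B.share_at N 0 j)"
    unfolding B.ps_alloc_eq_share N_def by (intro sum.cong) (use D n B.share_at_end in auto)
  \<comment> \<open>The bound \<open>T < 2/3\<close> enters here as \<open>T < 1\<close>.\<close>
  also have "\<dots> \<le> 3/2 * T"
    by (rule manipulation_bound[OF A.eating_flow B.eating_flow _ n T(1) _ _ D exhausted])
      (use assms B.stock_at_end in \<open>auto simp: T_def N_def\<close>)
  finally show ?thesis using truthful by simp
qed

end
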